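(* Let $\mathbb G$ be a finitely generated nilpotent group of nilpotency class at most $2$, and let $\mu$ be a symmetric, non-degenerate probability measure on $\mathbb G$ such that for every $z\in Z(\mathbb G)$, $$\big\|\mu^{(n)}-\mu^{(n)}*\delta_z\big\|_{\mathrm{TV}}\to0\quad\text{as } n\to\infty .$$ Then every bounded $\mu$-harmonic function on $\mathbb G$ is constant on cosets of the commutator subgroup $[\mathbb G,\mathbb G]$. Equivalently, every bounded $\mu$-harmonic function factors through the abelianisation $\pi:\mathbb G\to\mathbb G^{\mathrm{ab}}:=\mathbb G/[\mathbb G,\mathbb G]$, and pullback by $\pi$ identifies the spaces of bounded harmonic functions on $(\mathbb G,\mu)$ and on $(\mathbb G^{\mathrm{ab}},\pi_*\mu)$.
   Context: $Z(\mathbb G)$ is the centre; $\mu^{(n)}$ is the $n$-fold convolution power; $\|\nu_1-\nu_2\|_{\mathrm{TV}}=\frac12\sum_{g}|\nu_1(g)-\nu_2(g)|$. Non-degenerate: $\operatorname{supp}\mu$ generates $\mathbb G$ as a semigroup; symmetric: $\mu(g)=\mu(g^{-1})$. A function $f:\mathbb G\to\mathbb R$ is $\mu$-harmonic if $f(k)=\sum_g\mu(g)f(kg)$ for all $k\in\mathbb G$. The pushforward is $\pi_*\mu(g[\mathbb G,\mathbb G])=\sum_{h\in[\mathbb G,\mathbb G]}\mu(gh)$. *)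

theory Defs
  imports "HOL-Algebra.Algebra" "HOL-Probability.Probability"
begin

definition finitely_generated :: "('a, 'b) monoid_scheme \<Rightarrow> bool" where
  "finitely_generated G \<longleftrightarrow> (\<exists>S. finite S \<and> S \<subseteq> carrier G \<and> generate G S = carrier G)"

definition group_center :: "('a, 'b) monoid_scheme \<Rightarrow> 'a set" where
  "group_center G = {z \<in> carrier G. \<forall>g\<in>carrier G. z \<otimes>\<^bsub>G\<^esub> g = g \<otimes>\<^bsub>G\<^esub> z}"

definition commutator_subgroup :: "('a, 'b) monoid_scheme \<Rightarrow> 'a set \<Rightarrow> 'a set \<Rightarrow> 'a set" where
  "commutator_subgroup G H K =
     generate G (\<Union>h\<in>H. \<Union>k\<in>K. {h \<otimes>\<^bsub>G\<^esub> k \<otimes>\<^bsub>G\<^esub> inv\<^bsub>G\<^esub> h \<otimes>\<^bsub>G\<^esub> inv\<^bsub>G\<^esub> k})"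

text \<open>Indexing from 0: \<open>lower_central_series G c\<close> is the term usually written
  \<open>\<gamma>\<close> with index \<open>c + 1\<close>, so it is trivial iff the nilpotency class is at most \<open>c\<close>.\<close>

primrec lower_central_series :: "('a, 'b) monoid_scheme \<Rightarrow> nat \<Rightarrow> 'a set" where
  "lower_central_series G 0 = carrier G"
| "lower_central_series G (Suc n) =
     commutator_subgroup G (lower_central_series G n) (carrier G)"

definition nilpotent_of_class_le :: "('a, 'b) monoid_scheme \<Rightarrow> nat \<Rightarrow> bool" where
  "nilpotent_of_class_le G c \<longleftrightarrow> lower_central_series G c = {\<one>\<^bsub>G\<^esub>}"

lemma commutator_subgroup_eq_derived:
  "commutator_subgroup G (carrier G) (carrier G) = derived G (carrier G)"
  by (simp add: commutator_subgroup_def derived_def)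

inductive_set subsemigroup_generated :: "('a, 'b) monoid_scheme \<Rightarrow> 'a set \<Rightarrow> 'a set"
  for G and S where
  incl: "s \<in> S \<Longrightarrow> s \<in> subsemigroup_generated G S"
| mult: "x \<in> subsemigroup_generated G S \<Longrightarrow> y \<in> subsemigroup_generated G S \<Longrightarrow>
         x \<otimes>\<^bsub>G\<^esub> y \<in> subsemigroup_generated G S"

text \<open>A probability measure on a countable group is a \<open>pmf\<close> on the ambient type whose support
  lies in the carrier.\<close>

definition nondegenerate_pmf :: "('a, 'b) monoid_scheme \<Rightarrow> 'a pmf \<Rightarrow> bool" where
  "nondegenerate_pmf G \<mu> \<longleftrightarrow> subsemigroup_generated G (set_pmf \<mu>) = carrier G"

definition symmetric_pmf :: "('a, 'b) monoid_scheme \<Rightarrow> 'a pmf \<Rightarrow> bool" where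
  "symmetric_pmf G \<mu> \<longleftrightarrow> (\<forall>g\<in>carrier G. pmf \<mu> g = pmf \<mu> (inv\<^bsub>G\<^esub> g))"

definition conv_pmf :: "('a, 'b) monoid_scheme \<Rightarrow> 'a pmf \<Rightarrow> 'a pmf \<Rightarrow> 'a pmf" where
  "conv_pmf G \<mu> \<nu> = map_pmf (\<lambda>(g, h). g \<otimes>\<^bsub>G\<^esub> h) (pair_pmf \<mu> \<nu>)"

primrec conv_power :: "('a, 'b) monoid_scheme \<Rightarrow> 'a pmf \<Rightarrow> nat \<Rightarrow> 'a pmf" where
  "conv_power G \<mu> 0 = return_pmf \<one>\<^bsub>G\<^esub>"
| "conv_power G \<mu> (Suc n) = conv_pmf G (conv_power G \<mu> n) \<mu>"

definition tv_dist :: "('a, 'b) monoid_scheme \<Rightarrow> 'a pmf \<Rightarrow> 'a pmf \<Rightarrow> real" where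
  "tv_dist G \<nu>1 \<nu>2 = (1/2) * (\<Sum>\<^sub>\<infinity>g\<in>carrier G. \<bar>pmf \<nu>1 g - pmf \<nu>2 g\<bar>)"

text \<open>Using \<open>has_sum\<close> makes (unconditional) convergence of the defining series part of
  harmonicity; it is automatic for bounded \<open>f\<close>.\<close>

definition harmonic :: "('a, 'b) monoid_scheme \<Rightarrow> 'a pmf \<Rightarrow> ('a \<Rightarrow> real) \<Rightarrow> bool" where
  "harmonic G \<mu> f \<longleftrightarrow>
     (\<forall>k\<in>carrier G. ((\<lambda>g. pmf \<mu> g * f (k \<otimes>\<^bsub>G\<^esub> g)) has_sum f k) (carrier G))"

text \<open>Extensionality makes the elements correspond exactly to functions on the carrier.\<close>

definition bounded_harmonic :: "('a, 'b) monoid_scheme \<Rightarrow> 'a pmf \<Rightarrow> ('a \<Rightarrow> real) set" where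
  "bounded_harmonic G \<mu> =
     {f \<in> extensional (carrier G). bounded (f ` carrier G) \<and> harmonic G \<mu> f}"

definition abelianisation :: "('a, 'b) monoid_scheme \<Rightarrow> 'a set monoid" where
  "abelianisation G = G Mod derived G (carrier G)"

text \<open>\<open>FactGroup\<close> is built from right cosets; they agree with the left cosets because the
  derived subgroup is normal.\<close>

definition ab_proj :: "('a, 'b) monoid_scheme \<Rightarrow> 'a \<Rightarrow> 'a set" where
  "ab_proj G g = derived G (carrier G) #>\<^bsub>G\<^esub> g"

end

theory Submission
  imports Defs
begin

text \<open>
  Iterating the mean value property of a bounded harmonic function \<open>f\<close> shows that
  \<open>f k\<close> is the average of \<open>f (k g)\<close> when \<open>g\<close> is distributed according to any convolution power
  \<open>\<mu>\<^sup>n\<close> (\<open>bounded_harmonic_conv_power\<close>). If \<open>z\<close> is central, then \<open>k z g = k g z\<close>, so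
  \<open>f (k z)\<close> is the average of the same function \<open>g \<mapsto> f (k g)\<close>, now against the translate
  \<open>\<mu>\<^sup>n * \<delta>\<^sub>z\<close>. Averages of a function bounded by \<open>B\<close> against two measures differ by at most
  \<open>2 B\<close> times the total variation distance of these, which tends to \<open>0\<close> here; hence
  \<open>f (k z) = f k\<close> (\<open>bounded_harmonic_central_invariant\<close>).

  In a group of class at most \<open>2\<close> the commutator subgroup is central
  (\<open>derived_subset_center\<close>), so bounded harmonic functions are constant on its cosets.
  The assertion about the abelianisation then follows from a general fact about surjective
  homomorphisms (\<open>bij_betw_bounded_harmonic_pullback\<close>): pullback identifies the bounded harmonic
  functions for the image measure with those bounded harmonic functions that are constant on the
  fibres.
\<close>

section \<open>Expectations over discrete measures\<close>

lemma expectation_bind_bounded: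
  fixes h :: "'b \<Rightarrow> real"
  assumes "bounded (range h)"
  shows "measure_pmf.expectation (bind_pmf p q) h
       = measure_pmf.expectation p (\<lambda>x. measure_pmf.expectation (q x) h)"
proof -
  obtain B where B: "\<And>x. \<bar>h x\<bar> \<le> B"
    using assms by (auto simp: bounded_iff)
  show ?thesis
    unfolding measure_pmf_bind
    by (rule integral_bind[where K = "count_space UNIV" and B = B and B' = 1])
       (auto simp: B space_subprob_algebra measure_pmf.emeasure_space_1
          intro: measure_pmf.finite_measure_axioms measure_pmf.subprob_space_axioms)
qed

lemma expectation_conv_pmf:
  fixes h :: "'a \<Rightarrow> real"
  assumes "bounded (range h)"
  shows "measure_pmf.expectation (conv_pmf G p q) h
       = measure_pmf.expectation p (\<lambda>x. measure_pmf.expectation q (\<lambda>y. h (x \<otimes>\<^bsub>G\<^esub> y)))"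
proof -
  have "conv_pmf G p q = bind_pmf p (\<lambda>x. map_pmf (\<lambda>y. x \<otimes>\<^bsub>G\<^esub> y) q)"
    by (simp add: conv_pmf_def pair_pmf_def map_bind_pmf map_pmf_def bind_assoc_pmf bind_return_pmf)
  then show ?thesis
    by (simp add: expectation_bind_bounded[OF assms])
qed

lemma pmf_summable_on: "pmf p summable_on A"
  using abs_summable_equivalent[of "pmf p" A] pmf_abs_summable[of p A] by simp

text \<open>This translates between the series in the definitions of harmonicity and total variation and
  the integrals for which convolution is convenient.\<close>

lemma has_sum_expectation:
  fixes h :: "'a \<Rightarrow> real"
  assumes "set_pmf p \<subseteq> A" and "bounded (range h)"
  shows "((\<lambda>x. pmf p x * h x) has_sum measure_pmf.expectation p h) A"
proof -
  obtain B where B: "\<And>x. \<bar>h x\<bar> \<le> B"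
    using assms(2) by (auto simp: bounded_iff)
  have "(\<lambda>x. B * pmf p x) summable_on UNIV"
    by (intro summable_on_cmult_right pmf_summable_on)
  then have abs: "(\<lambda>x. norm (pmf p x * h x)) summable_on UNIV"
  proof (rule summable_on_comparison_test)
    show "norm (pmf p x * h x) \<le> B * pmf p x" for x
      using mult_right_mono[OF B pmf_nonneg, of x p x] by (simp add: abs_mult mult.commute)
  qed simp
  then have "((\<lambda>x. pmf p x * h x) has_sum measure_pmf.expectation p h) UNIV"
    unfolding pmf_expectation_eq_infsetsum
    using infsetsum_infsum[OF abs_summable_equivalent[THEN iffD1, OF abs]] abs_summable_summable[OF abs]
    by simp
  moreover have "((\<lambda>x. pmf p x * h x) has_sum measure_pmf.expectation p h) UNIV
      = ((\<lambda>x. pmf p x * h x) has_sum measure_pmf.expectation p h) A"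
    using assms(1) by (intro has_sum_cong_neutral) (auto simp: set_pmf_eq)
  ultimately show ?thesis by simp
qed

lemma expectation_diff_le_tv_dist:
  fixes h :: "'a \<Rightarrow> real"
  assumes "set_pmf p \<subseteq> carrier G" and "set_pmf q \<subseteq> carrier G" and B: "\<And>x. \<bar>h x\<bar> \<le> B"
  shows "\<bar>measure_pmf.expectation p h - measure_pmf.expectation q h\<bar> \<le> 2 * B * tv_dist G p q"
proof -
  have bdd: "bounded (range h)"
    using B by (auto simp: bounded_iff)
  have "((\<lambda>x. (pmf p x - pmf q x) * h x) has_sum
          (measure_pmf.expectation p h - measure_pmf.expectation q h)) (carrier G)"
    using has_sum_add[OF has_sum_expectation[OF assms(1) bdd]
        has_sum_uminusI[OF has_sum_expectation[OF assms(2) bdd]]]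
    by (simp add: left_diff_distrib)
  moreover have "(\<lambda>x. \<bar>pmf p x - pmf q x\<bar>) summable_on carrier G"
  proof (rule summable_on_comparison_test[OF summable_on_add[OF pmf_summable_on pmf_summable_on]])
    show "\<bar>pmf p x - pmf q x\<bar> \<le> pmf p x + pmf q x" for x
      using pmf_nonneg[of p x] pmf_nonneg[of q x] by linarith
  qed simp
  then have "((\<lambda>x. B * \<bar>pmf p x - pmf q x\<bar>) has_sum 2 * B * tv_dist G p q) (carrier G)"
    using has_sum_cmult_right[OF has_sum_infsum,
        of "\<lambda>x. \<bar>pmf p x - pmf q x\<bar>" "carrier G" B]
    by (simp add: tv_dist_def)
  moreover have "norm ((pmf p x - pmf q x) * h x) \<le> B * \<bar>pmf p x - pmf q x\<bar>" for x
    using mult_right_mono[OF B abs_ge_zero, of x "pmf p x - pmf q x"] by (simp add: abs_mult mult.commute)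
  ultimately have "norm (measure_pmf.expectation p h - measure_pmf.expectation q h)
      \<le> 2 * B * tv_dist G p q"
    by (rule norm_infsum_le)
  then show ?thesis by simp
qed

section \<open>Bounded harmonic functions and central translations\<close>

text \<open>Extensionality gives \<open>f\<close> a single value outside the carrier, so boundedness on the carrier is
  the same as boundedness on the whole type. The latter is what the integration lemmas ask for.\<close>

lemma bounded_harmonic_iff_expectation:
  assumes "monoid G" and supp: "set_pmf \<mu> \<subseteq> carrier G"
  shows "f \<in> bounded_harmonic G \<mu> \<longleftrightarrow>
     f \<in> extensional (carrier G) \<and> bounded (range f) \<and>
     (\<forall>k\<in>carrier G. measure_pmf.expectation \<mu> (\<lambda>g. f (k \<otimes>\<^bsub>G\<^esub> g)) = f k)"
proof -
  have "harmonic G \<mu> f \<longleftrightarrow>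
      (\<forall>k\<in>carrier G. measure_pmf.expectation \<mu> (\<lambda>g. f (k \<otimes>\<^bsub>G\<^esub> g)) = f k)"
    if "bounded (range f)"
  proof -
    have "((\<lambda>g. pmf \<mu> g * f (k \<otimes>\<^bsub>G\<^esub> g)) has_sum
            measure_pmf.expectation \<mu> (\<lambda>g. f (k \<otimes>\<^bsub>G\<^esub> g))) (carrier G)" for k
      by (rule has_sum_expectation[OF supp bounded_subset[OF that]]) auto
    then have "((\<lambda>g. pmf \<mu> g * f (k \<otimes>\<^bsub>G\<^esub> g)) has_sum f k) (carrier G)
        \<longleftrightarrow> measure_pmf.expectation \<mu> (\<lambda>g. f (k \<otimes>\<^bsub>G\<^esub> g)) = f k" for k
      using has_sum_unique by metis
    then show ?thesis
      by (simp add: harmonic_def)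
  qed
  moreover have "bounded (range f) \<longleftrightarrow> bounded (f ` carrier G)" if "f \<in> extensional (carrier G)"
  proof
    assume "bounded (f ` carrier G)"
    then have "bounded (insert undefined (f ` carrier G))" by simp
    then show "bounded (range f)"
      by (rule bounded_subset) (use that in \<open>auto simp: extensional_def\<close>)
  qed (auto intro: bounded_subset)
  ultimately show ?thesis
    unfolding bounded_harmonic_def by blast
qed

lemma set_conv_power_subset:
  assumes "monoid G" and "set_pmf \<mu> \<subseteq> carrier G"
  shows "set_pmf (conv_power G \<mu> n) \<subseteq> carrier G"
  using assms by (induction n) (auto simp: conv_pmf_def monoid.m_closed monoid.one_closed subset_iff)

text \<open>A \<open>\<mu>\<close>-distributed last step from \<open>k g\<close> averages to \<open>f (k g)\<close>, so each further step of the
  random walk preserves the mean.\<close>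

lemma bounded_harmonic_conv_power:
  assumes "monoid G" and supp: "set_pmf \<mu> \<subseteq> carrier G" and f: "f \<in> bounded_harmonic G \<mu>"
    and k: "k \<in> carrier G"
  shows "measure_pmf.expectation (conv_power G \<mu> n) (\<lambda>g. f (k \<otimes>\<^bsub>G\<^esub> g)) = f k"
proof (induction n)
  case 0
  then show ?case using \<open>monoid G\<close> k by (simp add: monoid.r_one)
next
  case (Suc n)
  have bdd: "bounded (range f)"
    and mean: "\<And>k. k \<in> carrier G \<Longrightarrow> measure_pmf.expectation \<mu> (\<lambda>g. f (k \<otimes>\<^bsub>G\<^esub> g)) = f k"
    using f bounded_harmonic_iff_expectation[OF \<open>monoid G\<close> supp] by blast+
  have "measure_pmf.expectation \<mu> (\<lambda>h. f (k \<otimes>\<^bsub>G\<^esub> (g \<otimes>\<^bsub>G\<^esub> h))) = f (k \<otimes>\<^bsub>G\<^esub> g)"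
    if "g \<in> set_pmf (conv_power G \<mu> n)" for g
  proof -
    have g: "g \<in> carrier G"
      using that set_conv_power_subset[OF \<open>monoid G\<close> supp] by blast
    have "measure_pmf.expectation \<mu> (\<lambda>h. f (k \<otimes>\<^bsub>G\<^esub> (g \<otimes>\<^bsub>G\<^esub> h)))
        = measure_pmf.expectation \<mu> (\<lambda>h. f (k \<otimes>\<^bsub>G\<^esub> g \<otimes>\<^bsub>G\<^esub> h))"
      using supp g k \<open>monoid G\<close>
      by (intro integral_cong_AE) (auto simp: AE_measure_pmf_iff monoid.m_assoc subset_iff)
    then show ?thesis
      using mean g k \<open>monoid G\<close> by (simp add: monoid.m_closed)
  qed
  then have "measure_pmf.expectation (conv_power G \<mu> n)
        (\<lambda>g. measure_pmf.expectation \<mu> (\<lambda>h. f (k \<otimes>\<^bsub>G\<^esub> (g \<otimes>\<^bsub>G\<^esub> h)))) = f k"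
    unfolding Suc.IH[symmetric] by (intro integral_cong_AE) (auto simp: AE_measure_pmf_iff)
  moreover have "bounded (range (\<lambda>g. f (k \<otimes>\<^bsub>G\<^esub> g)))"
    by (rule bounded_subset[OF bdd]) auto
  ultimately show ?case
    by (simp add: expectation_conv_pmf)
qed

text \<open>Centrality moves the translation by \<open>z\<close> from the starting point of the walk to its end point,
  where the total variation hypothesis makes it negligible.\<close>

lemma bounded_harmonic_central_invariant:
  assumes "monoid G" and supp: "set_pmf \<mu> \<subseteq> carrier G" and f: "f \<in> bounded_harmonic G \<mu>"
    and k: "k \<in> carrier G" and z: "z \<in> group_center G"
    and tv: "(\<lambda>n. tv_dist G (conv_power G \<mu> n) (conv_pmf G (conv_power G \<mu> n) (return_pmf z)))
        \<longlonglongrightarrow> 0"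
  shows "f (k \<otimes>\<^bsub>G\<^esub> z) = f k"
proof -
  let ?p = "\<lambda>n. conv_power G \<mu> n"
  let ?q = "\<lambda>n. conv_pmf G (?p n) (return_pmf z)"
  have zc: "z \<in> carrier G" and comm: "\<And>g. g \<in> carrier G \<Longrightarrow> z \<otimes>\<^bsub>G\<^esub> g = g \<otimes>\<^bsub>G\<^esub> z"
    using z by (auto simp: group_center_def)
  have bdd: "bounded (range f)"
    using f bounded_harmonic_iff_expectation[OF \<open>monoid G\<close> supp] by blast
  then obtain B where B: "\<And>x. \<bar>f x\<bar> \<le> B"
    by (auto simp: bounded_iff)
  have supp_n: "set_pmf (?p n) \<subseteq> carrier G" for n
    by (rule set_conv_power_subset[OF \<open>monoid G\<close> supp])
  have "\<bar>f k - f (k \<otimes>\<^bsub>G\<^esub> z)\<bar> \<le> 2 * B * tv_dist G (?p n) (?q n)" for n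
  proof -
    have "f (k \<otimes>\<^bsub>G\<^esub> z) = measure_pmf.expectation (?p n) (\<lambda>g. f (k \<otimes>\<^bsub>G\<^esub> z \<otimes>\<^bsub>G\<^esub> g))"
      using bounded_harmonic_conv_power[OF \<open>monoid G\<close> supp f] \<open>monoid G\<close> k zc
      by (simp add: monoid.m_closed)
    also have "\<dots> = measure_pmf.expectation (?p n) (\<lambda>g. f (k \<otimes>\<^bsub>G\<^esub> (g \<otimes>\<^bsub>G\<^esub> z)))"
      using supp_n[of n] k zc comm \<open>monoid G\<close>
      by (intro integral_cong_AE) (auto simp: AE_measure_pmf_iff monoid.m_assoc subset_iff)
    also have "\<dots> = measure_pmf.expectation (?q n) (\<lambda>g. f (k \<otimes>\<^bsub>G\<^esub> g))"
      by (subst expectation_conv_pmf) (auto intro: bounded_subset[OF bdd])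
    finally have "f (k \<otimes>\<^bsub>G\<^esub> z) = measure_pmf.expectation (?q n) (\<lambda>g. f (k \<otimes>\<^bsub>G\<^esub> g))" .
    moreover have "f k = measure_pmf.expectation (?p n) (\<lambda>g. f (k \<otimes>\<^bsub>G\<^esub> g))"
      using bounded_harmonic_conv_power[OF \<open>monoid G\<close> supp f k] by simp
    moreover have "set_pmf (?q n) \<subseteq> carrier G"
      using supp_n[of n] zc \<open>monoid G\<close> by (auto simp: conv_pmf_def monoid.m_closed subset_iff)
    ultimately show ?thesis
      using expectation_diff_le_tv_dist[OF supp_n, of "?q n" "\<lambda>g. f (k \<otimes>\<^bsub>G\<^esub> g)" B] B by simp
  qed
  moreover have "(\<lambda>n. 2 * B * tv_dist G (?p n) (?q n)) \<longlonglongrightarrow> 2 * B * 0"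
    by (intro tendsto_mult_left tv)
  ultimately have "\<bar>f k - f (k \<otimes>\<^bsub>G\<^esub> z)\<bar> \<le> 0"
    by (intro LIMSEQ_le_const[of _ "0::real"]) auto
  then show ?thesis by simp
qed

text \<open>The next term of the lower central series consists of the commutators of elements of the
  derived subgroup with arbitrary elements; class at most \<open>2\<close> says that these are trivial.\<close>

lemma (in group) derived_subset_center:
  assumes "nilpotent_of_class_le G 2"
  shows "derived G (carrier G) \<subseteq> group_center G"
proof
  fix d assume d: "d \<in> derived G (carrier G)"
  have dc: "d \<in> carrier G"
    using d derived_in_carrier[OF subset_refl] by blast
  have lcs: "commutator_subgroup G (derived G (carrier G)) (carrier G) = {\<one>}"
    using assms by (simp add: nilpotent_of_class_le_def numeral_2_eq_2 commutator_subgroup_eq_derived)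
  have "d \<otimes> g = g \<otimes> d" if g: "g \<in> carrier G" for g
  proof -
    have "d \<otimes> g \<otimes> inv d \<otimes> inv g \<in> commutator_subgroup G (derived G (carrier G)) (carrier G)"
      unfolding commutator_subgroup_def using d g by (intro generate.incl) auto
    then have "d \<otimes> g \<otimes> inv (g \<otimes> d) = \<one>"
      using lcs d g dc by (simp add: inv_mult_group m_assoc)
    then show ?thesis
      using g dc by (metis inv_closed inv_equality inv_inv m_closed)
  qed
  then show "d \<in> group_center G"
    using dc by (simp add: group_center_def)
qed

section \<open>Pullback along a surjective homomorphism\<close>

text \<open>The mean of the pullback of \<open>F\<close> around \<open>k\<close> is the mean of \<open>F\<close> around \<open>\<phi> k\<close> for the image
  measure, and by surjectivity every point of the target is some \<open>\<phi> k\<close>.\<close>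

lemma bounded_harmonic_pullback_iff:
  fixes G :: "('a, 'b) monoid_scheme" and H :: "('c, 'd) monoid_scheme"
  assumes "monoid G" and "monoid H" and supp: "set_pmf \<mu> \<subseteq> carrier G"
    and hom: "\<phi> \<in> hom G H" and surj: "\<phi> ` carrier G = carrier H"
    and ext: "F \<in> extensional (carrier H)"
  shows "restrict (F \<circ> \<phi>) (carrier G) \<in> bounded_harmonic G \<mu>
     \<longleftrightarrow> F \<in> bounded_harmonic H (map_pmf \<phi> \<mu>)"
proof -
  let ?f = "restrict (F \<circ> \<phi>) (carrier G)"
  have supp': "set_pmf (map_pmf \<phi> \<mu>) \<subseteq> carrier H"
    using supp surj by auto
  have "bounded (range ?f) \<longleftrightarrow> bounded (range F)"
  proof -
    have "range ?f \<subseteq> insert undefined (range F)"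
      by auto
    moreover have "range F \<subseteq> insert undefined (range ?f)"
    proof
      fix v assume "v \<in> range F"
      then obtain h where h: "v = F h" by blast
      show "v \<in> insert undefined (range ?f)"
      proof (cases "h \<in> carrier H")
        case True
        then obtain g where "g \<in> carrier G" "h = \<phi> g"
          using surj by blast
        then have "?f g = v" using h by simp
        then show ?thesis by blast
      next
        case False
        then show ?thesis using ext h by (simp add: extensional_def)
      qed
    qed
    ultimately show ?thesis
      by (meson bounded_insert bounded_subset)
  qed
  moreover have "measure_pmf.expectation \<mu> (\<lambda>g. ?f (k \<otimes>\<^bsub>G\<^esub> g))
      = measure_pmf.expectation (map_pmf \<phi> \<mu>) (\<lambda>h. F (\<phi> k \<otimes>\<^bsub>H\<^esub> h))" if "k \<in> carrier G" for k
    using that supp hom \<open>monoid G\<close> unfolding integral_map_pmf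
    by (intro integral_cong_AE) (auto simp: AE_measure_pmf_iff monoid.m_closed hom_mult subset_iff)
  ultimately show ?thesis
    unfolding bounded_harmonic_iff_expectation[OF \<open>monoid G\<close> supp]
      bounded_harmonic_iff_expectation[OF \<open>monoid H\<close> supp']
    using ext by (simp add: surj[symmetric])
qed

text \<open>A function constant on the fibres descends to the target along any choice of preimages, and the
  descended function is harmonic because its pullback is.\<close>

lemma bij_betw_bounded_harmonic_pullback:
  fixes G :: "('a, 'b) monoid_scheme" and H :: "('c, 'd) monoid_scheme"
  assumes "monoid G" and "monoid H" and supp: "set_pmf \<mu> \<subseteq> carrier G"
    and hom: "\<phi> \<in> hom G H" and surj: "\<phi> ` carrier G = carrier H"
  shows "bij_betw (\<lambda>F. restrict (F \<circ> \<phi>) (carrier G)) (bounded_harmonic H (map_pmf \<phi> \<mu>))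
     {f \<in> bounded_harmonic G \<mu>. \<forall>x\<in>carrier G. \<forall>y\<in>carrier G. \<phi> x = \<phi> y \<longrightarrow> f x = f y}"
    (is "bij_betw ?pull ?BH ?BG")
proof (rule bij_betw_imageI)
  have ext: "F \<in> extensional (carrier H)" if "F \<in> ?BH" for F
    using that by (simp add: bounded_harmonic_def)
  note pull_iff = bounded_harmonic_pullback_iff[OF \<open>monoid G\<close> \<open>monoid H\<close> supp hom surj]
  show "inj_on ?pull ?BH"
  proof (rule inj_onI)
    fix F F' assume F: "F \<in> ?BH" "F' \<in> ?BH" and eq: "?pull F = ?pull F'"
    show "F = F'"
    proof (rule extensionalityI[OF ext[OF F(1)] ext[OF F(2)]])
      fix h assume "h \<in> carrier H"
      then obtain g where "g \<in> carrier G" "h = \<phi> g"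
        using surj by blast
      then show "F h = F' h"
        using fun_cong[OF eq, of g] by simp
    qed
  qed
  show "?pull ` ?BH = ?BG"
  proof
    show "?pull ` ?BH \<subseteq> ?BG"
    proof
      fix f assume "f \<in> ?pull ` ?BH"
      then obtain F where F: "F \<in> ?BH" and f: "f = ?pull F" by blast
      have "f \<in> bounded_harmonic G \<mu>"
        unfolding f using pull_iff[OF ext[OF F]] F by (rule iffD2)
      then show "f \<in> ?BG" by (simp add: f)
    qed
    show "?BG \<subseteq> ?pull ` ?BH"
    proof
      fix f assume f: "f \<in> ?BG"
      define F where "F = restrict (f \<circ> inv_into (carrier G) \<phi>) (carrier H)"
      have "?pull F = f"
      proof (rule extensionalityI[of _ "carrier G"])
        show "f \<in> extensional (carrier G)"
          using f by (simp add: bounded_harmonic_def)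
        fix g assume g: "g \<in> carrier G"
        then have img: "\<phi> g \<in> \<phi> ` carrier G" by blast
        have "f (inv_into (carrier G) \<phi> (\<phi> g)) = f g"
          using f g inv_into_into[OF img] f_inv_into_f[OF img] by blast
        then show "?pull F g = f g"
          using g img by (simp add: F_def surj)
      qed simp
      moreover have "F \<in> ?BH"
      proof (rule iffD1[OF pull_iff])
        show "F \<in> extensional (carrier H)" by (simp add: F_def)
        show "?pull F \<in> bounded_harmonic G \<mu>" using f \<open>?pull F = f\<close> by simp
      qed
      ultimately show "f \<in> ?pull ` ?BH" by blast
    qed
  qed
qed

section \<open>Factorisation through the abelianisation\<close>

theorem proposition7p19:
  fixes G :: "('a, 'b) monoid_scheme" and \<mu> :: "'a pmf"
  assumes "group G"
    and "finitely_generated G"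
    and "nilpotent_of_class_le G 2"
    and "set_pmf \<mu> \<subseteq> carrier G"
    and "symmetric_pmf G \<mu>"
    and "nondegenerate_pmf G \<mu>"
    and "\<And>z. z \<in> group_center G \<Longrightarrow>
      (\<lambda>n. tv_dist G (conv_power G \<mu> n) (conv_pmf G (conv_power G \<mu> n) (return_pmf z)))
        \<longlonglongrightarrow> 0"
  shows "(\<forall>f \<in> bounded_harmonic G \<mu>. \<forall>C \<in> rcosets\<^bsub>G\<^esub> (derived G (carrier G)).
            \<forall>x\<in>C. \<forall>y\<in>C. f x = f y)
       \<and> (\<forall>f \<in> bounded_harmonic G \<mu>. \<exists>F :: 'a set \<Rightarrow> real. \<forall>g\<in>carrier G. f g = F (ab_proj G g))
       \<and> bij_betw (\<lambda>F. restrict (F \<circ> ab_proj G) (carrier G))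
           (bounded_harmonic (abelianisation G) (map_pmf (ab_proj G) \<mu>))
           (bounded_harmonic G \<mu>)"
proof -
  interpret group G by fact
  let ?D = "derived G (carrier G)"
  interpret D: normal ?D G by (rule derived_self_is_normal)
  note supp = assms(4)
  have inv: "f (k \<otimes>\<^bsub>G\<^esub> d) = f k"
    if "f \<in> bounded_harmonic G \<mu>" "k \<in> carrier G" "d \<in> ?D" for f k d
    using bounded_harmonic_central_invariant[OF monoid_axioms supp that(1,2) _ assms(7)]
      derived_subset_center[OF assms(3)] that(3) by blast
  \<comment> \<open>The cosets here have the form \<open>D k\<close>; centrality lets the factor in \<open>D\<close> move to the right.\<close>
  have coset: "f x = f k"
    if f: "f \<in> bounded_harmonic G \<mu>" and k: "k \<in> carrier G" and x: "x \<in> ?D #>\<^bsub>G\<^esub> k" for f k x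
  proof -
    obtain d where d: "d \<in> ?D" and "x = d \<otimes>\<^bsub>G\<^esub> k"
      using x by (auto simp: r_coset_def)
    moreover have "d \<otimes>\<^bsub>G\<^esub> k = k \<otimes>\<^bsub>G\<^esub> d"
      using derived_subset_center[OF assms(3)] d k by (auto simp: group_center_def)
    ultimately show ?thesis
      using inv[OF f k d] by simp
  qed
  have fibres: "f x = f y"
    if "f \<in> bounded_harmonic G \<mu>" "x \<in> carrier G" "y \<in> carrier G" "ab_proj G x = ab_proj G y" for f x y
    using coset[OF that(1,3)] rcos_self[OF that(2) D.subgroup_axioms] that(4) by (simp add: ab_proj_def)
  have "bij_betw (\<lambda>F. restrict (F \<circ> ab_proj G) (carrier G))
      (bounded_harmonic (abelianisation G) (map_pmf (ab_proj G) \<mu>))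
      {f \<in> bounded_harmonic G \<mu>.
        \<forall>x\<in>carrier G. \<forall>y\<in>carrier G. ab_proj G x = ab_proj G y \<longrightarrow> f x = f y}"
  proof (rule bij_betw_bounded_harmonic_pullback[OF monoid_axioms _ supp])
    show "monoid (abelianisation G)"
      using derived_quot_is_group by (simp add: abelianisation_def group.is_monoid)
    show "ab_proj G \<in> hom G (abelianisation G)"
      using D.r_coset_hom_Mod by (simp add: abelianisation_def ab_proj_def[abs_def])
    show "ab_proj G ` carrier G = carrier (abelianisation G)"
      by (auto simp: abelianisation_def FactGroup_def RCOSETS_def ab_proj_def)
  qed
  moreover have "{f \<in> bounded_harmonic G \<mu>.
        \<forall>x\<in>carrier G. \<forall>y\<in>carrier G. ab_proj G x = ab_proj G y \<longrightarrow> f x = f y} = bounded_harmonic G \<mu>"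
    using fibres by blast
  ultimately have bij: "bij_betw (\<lambda>F. restrict (F \<circ> ab_proj G) (carrier G))
      (bounded_harmonic (abelianisation G) (map_pmf (ab_proj G) \<mu>)) (bounded_harmonic G \<mu>)"
    by simp
  have "\<forall>f \<in> bounded_harmonic G \<mu>. \<exists>F :: 'a set \<Rightarrow> real. \<forall>g\<in>carrier G. f g = F (ab_proj G g)"
  proof
    fix f assume "f \<in> bounded_harmonic G \<mu>"
    then obtain F where "f = restrict (F \<circ> ab_proj G) (carrier G)"
      using bij_betw_imp_surj_on[OF bij] by blast
    then show "\<exists>F :: 'a set \<Rightarrow> real. \<forall>g\<in>carrier G. f g = F (ab_proj G g)"
      by auto
  qed
  moreover have "\<forall>f \<in> bounded_harmonic G \<mu>. \<forall>C \<in> rcosets\<^bsub>G\<^esub> ?D. \<forall>x\<in>C. \<forall>y\<in>C. f x = f y"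
  proof (intro ballI)
    fix f C x y
    assume f: "f \<in> bounded_harmonic G \<mu>" and "C \<in> rcosets\<^bsub>G\<^esub> ?D" and "x \<in> C" "y \<in> C"
    then obtain k where "k \<in> carrier G" "x \<in> ?D #>\<^bsub>G\<^esub> k" "y \<in> ?D #>\<^bsub>G\<^esub> k"
      by (auto simp: RCOSETS_def)
    then show "f x = f y"
      using coset[OF f] by metis
  qed
  ultimately show ?thesis
    using bij by blast
qed

end
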